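(* For each integer $n\ge 1$ let $E_n$ denote the expected length of a game of solitaire memory with $2n$ cards, played with the optimal strategy. Then $$E_n = (3 - 2\ln 2)\,n + \frac{7}{8} - 2\ln 2 + \epsilon_n,\qquad\text{where } \lim_{n\to\infty}\epsilon_n = 0.$$
   Context: Solitaire memory with $2n$ cards: the deck has $2n$ cards numbered with $1,\dots,n$, each number appearing on exactly two cards (two cards with the same number match and are called mates). The deck is shuffled uniformly at random and the cards are laid face down in a row (so all arrangements of the multiset $\{1,1,2,2,\dots,n,n\}$ are equally likely). A move consists of flipping over first one card and then a second one. If they match, both are removed from play; otherwise both are flipped back face down. The game ends when all pairs have been removed. The length of a game is its total number of moves. The player has perfect memory. A card is unknown if it has never been flipped, and known if it has been flipped before. The optimal strategy, which the player is assumed to use, consists of the following move, repeated until the game ends. (1) If the positions of both cards of some pair still in play are known, flip these two cards and remove them. (2) Otherwise, flip over an unknown card; if its mate is known, flip the mate and remove both; if its mate is not known, flip over another unknown card (and remove the two cards if they happen to match). By convention, whenever an unknown card is to be flipped, the leftmost unknown card is chosen. The expectation is over the uniformly random arrangement of the deck. *)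

theory Defs
  imports "HOL-Probability.Probability" "HOL-Combinatorics.Multiset_Permutations"
begin

text \<open>
  An arrangement of the deck is a list \<open>d\<close> of numbers, where \<open>d ! i\<close> is the number on the card
  at position \<open>i\<close>.
\<close>

definition decks :: "nat \<Rightarrow> nat list set" where
  "decks n = permutations_of_multiset (repeat_mset 2 (mset_set {1..n}))"

definition positions :: "nat list \<Rightarrow> nat set" where
  "positions d = {..<length d}"

text \<open>The positions of the card at position \<open>i\<close> and of its mate.\<close>

definition pair :: "nat list \<Rightarrow> nat \<Rightarrow> nat set" where
  "pair d i = {j \<in> positions d. d ! j = d ! i}"

definition leftmost_unknown :: "nat list \<Rightarrow> nat set \<Rightarrow> nat" where
  "leftmost_unknown d K = Min (positions d - K)"

text \<open>
  One move of the optimal strategy. In a state \<open>(K, R)\<close>, \<open>K\<close> is the set of positions of the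
  known cards, i.e. those that have ever been flipped, including the ones removed since, and
  \<open>R\<close> is the set of positions whose cards have been removed. The minimum in the first branch
  only serves to name a completely known pair still in play: in the course of a game there is
  never more than one. In the last branch, the mate of the card at \<open>u\<close> is unknown, so that
  there is a further unknown card.
\<close>

definition move :: "nat list \<Rightarrow> nat set \<times> nat set \<Rightarrow> nat set \<times> nat set" where
  "move d = (\<lambda>(K, R).
     if \<exists>i \<in> K - R. pair d i \<subseteq> K
     then (K, R \<union> pair d (Min {i \<in> K - R. pair d i \<subseteq> K}))
     else
       let u = leftmost_unknown d K in
       if pair d u \<subseteq> insert u K
       then (insert u K, R \<union> pair d u)
       else
         let v = leftmost_unknown d (insert u K) in
         (insert v (insert u K), if d ! v = d ! u then R \<union> pair d u else R))"

definition game_length :: "nat list \<Rightarrow> nat" where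
  "game_length d = (LEAST m. snd ((move d ^^ m) ({}, {})) = positions d)"

definition expected_length :: "nat \<Rightarrow> real" where
  "expected_length n = measure_pmf.expectation (pmf_of_set (decks n)) (\<lambda>d. real (game_length d))"

end

theory Submission
  imports Defs "HOL-Real_Asymp.Real_Asymp"
begin

text \<open>
  Call a position a phase start if it is the leftmost unknown one at the beginning of a move with no
  known pair in play. A card at a phase start whose mate lies to its left uses up one position, any other uses up two.
  Exactly \<open>n\<close> moves remove a pair, and a move without success begins at a phase start carrying the
  first card of a pair that is not immediately followed by its mate. So the length is \<open>n + F - L\<close>,
  where \<open>F\<close> counts the phase starts at first cards of pairs and \<open>L\<close> those among them followed by
  their mates.

  By inclusion-exclusion, \<open>F\<close> is the alternating sum over \<open>j \<ge> 1\<close> of the number of windows of \<open>j\<close>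
  consecutive first cards. Deleting the last card and its mate gives a recursion in \<open>n\<close> for the mean
  \<open>T n j\<close> of this number, and deleting an adjacent pair expresses the mean of \<open>L\<close> for \<open>n + 1\<close>
  through that of \<open>F\<close> for \<open>n\<close>. Let \<open>g n\<close> be the mean of \<open>F\<close> divided by \<open>2n + 1\<close>. It tends to
  \<open>1/2 - 1/3 + 1/4 - \<dots> = 1 - ln 2\<close>, since \<open>T n j / (2n + 1)\<close> tends to \<open>1 / (j + 1)\<close> and \<open>T n j\<close>
  decreases in \<open>j\<close>. A telescoping identity gives \<open>g (n + 1) - g n = b n / ((2n + 1)(2n + 3))\<close>, where \<open>b\<close>
  satisfies a first-order recurrence with asymptotic factor \<open>-1/3\<close>, so that \<open>b\<close> tends to \<open>1/4\<close>;
  summation gives the second-order term of \<open>g\<close>.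
\<close>

subsection \<open>Windows of first occurrences\<close>

definition first_occ :: "'a list \<Rightarrow> nat \<Rightarrow> bool" where
  "first_occ d p \<longleftrightarrow> d ! p \<notin> set (take p d)"

text \<open>Here and below, \<open>N p\<close> says that the card at position \<open>p\<close> is the first one of its pair.\<close>

fun phase_start :: "(nat \<Rightarrow> bool) \<Rightarrow> nat \<Rightarrow> bool" where
  "phase_start N 0 \<longleftrightarrow> True"
| "phase_start N (Suc p) \<longleftrightarrow> \<not> (phase_start N p \<and> N p)"

definition window :: "(nat \<Rightarrow> bool) \<Rightarrow> nat \<Rightarrow> nat \<Rightarrow> real" where
  "window N j q = of_bool (\<forall>i<j. N (q + i))"

text \<open>Truncated subtraction makes the range empty for \<open>j > M\<close>. For
  \<open>j = 0\<close> there are \<open>M + 1\<close> empty windows, which start the recursion in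
  \<open>j\<close>.\<close>

definition windows :: "(nat \<Rightarrow> bool) \<Rightarrow> nat \<Rightarrow> nat \<Rightarrow> real" where
  "windows N M j = (\<Sum>q<Suc M - j. window N j q)"

lemma window_Suc: "window N (Suc j) q = window N j q * of_bool (N (q + j))"
  by (auto simp: window_def less_Suc_eq)

lemma phase_start_cong: "(\<And>i. i < p \<Longrightarrow> N i = N' i) \<Longrightarrow> phase_start N p = phase_start N' p"
  by (induction p) auto

text \<open>Position \<open>p\<close> is counted exactly when the run of first cards ending at
  \<open>p\<close> has odd length, and the windows ending at \<open>p\<close> have all lengths from
  1 up to that of the run. The induction uses that \<open>p + 1\<close> is counted iff it carries a
  first card and \<open>p\<close> is not counted.\<close>

lemma first_start_windows:
  "of_bool (phase_start N p \<and> N p) = (\<Sum>j\<le>p. (- 1) ^ j * window N (Suc j) (p - j))"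
proof (induction p)
  case 0
  show ?case by (simp add: window_def)
next
  case (Suc p)
  have "of_bool (phase_start N (Suc p) \<and> N (Suc p))
      = of_bool (N (Suc p)) - of_bool (N (Suc p)) * (of_bool (phase_start N p \<and> N p) :: real)"
    by auto
  also have "\<dots> = window N 1 (Suc p)
      + (\<Sum>j\<le>p. (- 1) ^ Suc j * (of_bool (N (Suc p)) * window N (Suc j) (p - j)))"
    unfolding Suc.IH by (simp add: window_def sum_negf sum_distrib_left mult_ac)
  also have "(\<Sum>j\<le>p. (- 1) ^ Suc j * (of_bool (N (Suc p)) * window N (Suc j) (p - j)))
     = (\<Sum>j\<le>p. (- 1) ^ Suc j * window N (Suc (Suc j)) (Suc p - Suc j))"
    by (intro sum.cong refl) (simp add: window_Suc[of _ "Suc _"])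
  also have "window N 1 (Suc p) + \<dots> = (\<Sum>j\<le>Suc p. (- 1) ^ j * window N (Suc j) (Suc p - j))"
    by (subst sum.atMost_Suc_shift) simp
  finally show ?case .
qed

lemma windows_Suc: "j \<le> M \<Longrightarrow> windows N (Suc M) (Suc j) = windows N M (Suc j) + window N (Suc j) (M - j)"
  by (simp add: windows_def Suc_diff_le)

lemma windows_0: "windows N M 0 = real M + 1"
  by (simp add: windows_def window_def)

lemma windows_eq_0: "M < j \<Longrightarrow> windows N M j = 0"
  by (simp add: windows_def)

text \<open>Sums \<open>first_start_windows\<close> and collects windows by length: passing from
  \<open>M\<close> to \<open>Suc M\<close> adds exactly the windows ending at position
  \<open>M\<close>.\<close>

lemma count_first_starts:
  "(\<Sum>p<M. of_bool (phase_start N p \<and> N p)) = (\<Sum>j<M. (- 1) ^ j * windows N M (Suc j))"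
proof (induction M)
  case (Suc M)
  have "(\<Sum>j<Suc M. (- 1) ^ j * windows N (Suc M) (Suc j))
      = (\<Sum>j\<le>M. (- 1) ^ j * windows N M (Suc j)) + (\<Sum>j\<le>M. (- 1) ^ j * window N (Suc j) (M - j))"
    unfolding lessThan_Suc_atMost sum.distrib[symmetric]
    by (intro sum.cong refl) (simp add: windows_Suc algebra_simps)
  also have "(\<Sum>j\<le>M. (- 1) ^ j * windows N M (Suc j)) = (\<Sum>p<M. of_bool (phase_start N p \<and> N p))"
    using Suc.IH by (simp add: windows_eq_0 flip: lessThan_Suc_atMost)
  finally show ?case by (simp add: first_start_windows)
qed simp

section \<open>Effect of inserting a first card on the windows\<close>

definition insert_at :: "nat \<Rightarrow> (nat \<Rightarrow> bool) \<Rightarrow> nat \<Rightarrow> bool" where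
  "insert_at p N i = (if i < p then N i else if i = p then True else N (i - 1))"

lemma window_insert_before: "p < q \<Longrightarrow> window (insert_at p N) j q = window N j (q - 1)"
  by (auto simp: window_def insert_at_def)

lemma window_insert_after: "q + j \<le> p \<Longrightarrow> window (insert_at p N) j q = window N j q"
  by (auto simp: window_def insert_at_def)

lemma window_insert_inside:
  assumes "q \<le> p" "p < q + Suc j"
  shows "window (insert_at p N) (Suc j) q = window N j q"
proof -
  have "(\<forall>i<Suc j. insert_at p N (q + i)) \<longleftrightarrow> (\<forall>i<j. N (q + i))"
  proof (intro iffI allI impI)
    fix i assume *: "\<forall>i<Suc j. insert_at p N (q + i)" "i < j"
    show "N (q + i)"
    proof (cases "q + i < p")
      case True
      thus ?thesis using * by (auto simp: insert_at_def dest: spec[of _ i])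
    next
      case False
      thus ?thesis using * by (auto simp: insert_at_def dest: spec[of _ "Suc i"])
    qed
  next
    fix i assume *: "\<forall>i<j. N (q + i)" "i < Suc j"
    show "insert_at p N (q + i)"
    proof (cases "q + i \<le> p")
      case True
      thus ?thesis using * assms by (auto simp: insert_at_def)
    next
      case False
      then obtain k where "i = Suc k" using assms by (cases i) auto
      thus ?thesis using False * by (auto simp: insert_at_def)
    qed
  qed
  thus ?thesis by (simp add: window_def)
qed

text \<open>
  A window of length \<open>j + 1\<close> avoiding the inserted position is an old window, which survives all but
  \<open>j\<close> of the \<open>M + 1\<close> insertions; one containing it arises from an old window of length \<open>j\<close>, in
  \<open>j + 1\<close> ways.
\<close>

lemma sum_windows_insert:
  "(\<Sum>p\<le>M. windows (insert_at p N) (Suc M) (Suc j)) =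
     (real M + 1 - real j) * windows N M (Suc j) + (real j + 1) * windows N M j"
proof -
  let ?w = "\<lambda>q. window N (Suc j) q"
  \<comment> \<open>For \<open>q = 0\<close> the truncated \<open>q - 1\<close> does no harm, its
    factor being 0.\<close>
  have inner: "(\<Sum>p\<le>M. window (insert_at p N) (Suc j) q)
      = real q * ?w (q - 1) + real (M - (q + j)) * ?w q + (real j + 1) * window N j q"
    if "q < Suc M - j" for q
  proof -
    \<comment> \<open>The insertion happens to the left of the window, inside it, or to its
      right.\<close>
    have eq: "{..M} = {..<q} \<union> ({q..q+j} \<union> {q+Suc j..M})"
      using that by auto
    have "(\<Sum>p\<le>M. window (insert_at p N) (Suc j) q)
        = (\<Sum>p<q. window (insert_at p N) (Suc j) q) + ((\<Sum>p=q..q+j. window (insert_at p N) (Suc j) q)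
          + (\<Sum>p=q+Suc j..M. window (insert_at p N) (Suc j) q))"
      unfolding eq by (subst sum.union_disjoint, simp, simp, force, subst sum.union_disjoint) auto
    also have "\<dots> = (\<Sum>p<q. ?w (q - 1)) + ((\<Sum>p=q..q+j. window N j q) + (\<Sum>p=q+Suc j..M. ?w q))"
      by (intro arg_cong2[where f = "(+)"] sum.cong refl)
         (auto simp: window_insert_before window_insert_after window_insert_inside)
    finally show ?thesis by (simp add: algebra_simps)
  qed
  have "(\<Sum>p\<le>M. windows (insert_at p N) (Suc M) (Suc j))
      = (\<Sum>q<Suc M - j. \<Sum>p\<le>M. window (insert_at p N) (Suc j) q)"
    unfolding windows_def by (subst sum.swap) simp
  also have "\<dots> = (\<Sum>q<Suc M - j. real q * ?w (q - 1)) + (\<Sum>q<Suc M - j. real (M - (q + j)) * ?w q)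
      + (real j + 1) * windows N M j"
    by (simp add: inner sum.distrib windows_def sum_distrib_left)
  also have "(\<Sum>q<Suc M - j. real q * ?w (q - 1)) + (\<Sum>q<Suc M - j. real (M - (q + j)) * ?w q)
      = (real M + 1 - real j) * windows N M (Suc j)"
  proof (cases "j \<le> M")
    case True
    \<comment> \<open>After an index shift, the old window at \<open>q\<close> has factor
      \<open>Suc q\<close> from insertions to its left and \<open>M - (q + j)\<close> from those to
      its right, together \<open>M + 1 - j\<close>.\<close>
    have "(\<Sum>q<Suc M - j. real q * ?w (q - 1)) = (\<Sum>q<M - j. real (Suc q) * ?w q)"
      using True by (simp add: Suc_diff_le sum.lessThan_Suc_shift del: sum.lessThan_Suc)
    moreover have "(\<Sum>q<Suc M - j. real (M - (q + j)) * ?w q) = (\<Sum>q<M - j. real (M - (q + j)) * ?w q)"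
      using True by (simp add: Suc_diff_le)
    ultimately have "(\<Sum>q<Suc M - j. real q * ?w (q - 1)) + (\<Sum>q<Suc M - j. real (M - (q + j)) * ?w q)
        = (\<Sum>q<M - j. real (Suc q) * ?w q + real (M - (q + j)) * ?w q)"
      by (simp add: sum.distrib)
    also have "\<dots> = (\<Sum>q<M - j. (real M + 1 - real j) * ?w q)"
      by (intro sum.cong refl) (auto simp: of_nat_diff algebra_simps)
    finally show ?thesis by (simp add: windows_def sum_distrib_left)
  qed (simp add: windows_def)
  finally show ?thesis .
qed

subsection \<open>Asymptotics of the alternating window sums\<close>

text \<open>The recursion averages over the \<open>2n + 1\<close> places for the first card of a new
  pair whose second card comes last; \<open>sum_windows_decks\<close> gives the link to
  decks.\<close>

fun mean_windows :: "nat \<Rightarrow> nat \<Rightarrow> real" where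
  "mean_windows 0 j = of_bool (j = 0)"
| "mean_windows (Suc n) j = (if j = 0 then 2 * real n + 3 else
     ((2 * real n + 2 - real j) * mean_windows n j + real j * mean_windows n (j - 1)) / (2 * real n + 1))"

lemma mean_windows_0 [simp]: "mean_windows n 0 = 2 * real n + 1"
  by (cases n) auto

lemma mean_windows_Suc_Suc:
  "(2 * real n + 1) * mean_windows (Suc n) (Suc j) =
     (2 * real n + 1 - real j) * mean_windows n (Suc j) + (real j + 1) * mean_windows n j"
  by (simp add: field_simps)

declare mean_windows.simps(2) [simp del]

lemma mean_windows_eq_0: "n < j \<Longrightarrow> mean_windows n j = 0"
  by (induction n arbitrary: j) (auto simp: mean_windows.simps(2))

text \<open>As a function of \<open>j\<close> this is a hypergeometric sequence starting at
  \<open>2n + 1\<close>. The recursion expresses two consecutive terms for \<open>n + 1\<close> by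
  three for \<open>n\<close>, which are linked by two instances of the induction hypothesis.\<close>

lemma mean_windows_ratio:
  "2 * (real j + 1) * (real n - real j) * mean_windows n j =
     (2 * real n + 1 - real j) * (real j + 2) * mean_windows n (Suc j)"
proof (induction n arbitrary: j)
  case 0
  show ?case by auto
next
  case (Suc n)
  let ?N = "2 * real n + 1"
  show ?case
  proof (cases j)
    case 0
    have "?N * mean_windows (Suc n) 1 = ?N * mean_windows n 1 + ?N"
      using mean_windows_Suc_Suc[of n 0] by simp
    hence "?N * (mean_windows (Suc n) 1 - (mean_windows n 1 + 1)) = 0"
      by (simp add: algebra_simps)
    moreover have "?N \<noteq> 0"
      by linarith
    ultimately have "mean_windows (Suc n) 1 = mean_windows n 1 + 1"
      by auto
    \<comment> \<open>A window of length 1 is just a first card, and \<open>n\<close> pairs have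
      \<open>n\<close> of them.\<close>
    moreover have "mean_windows n 1 = real n"
    proof -
      have "?N * (mean_windows n 1 - real n) = 0"
        using Suc.IH[of 0] by (simp add: algebra_simps)
      thus ?thesis using \<open>?N \<noteq> 0\<close> by simp
    qed
    ultimately show ?thesis using 0 by (simp add: algebra_simps)
  next
    case (Suc i)
    define a where "a = mean_windows n i"
    define b where "b = mean_windows n (Suc i)"
    define c where "c = mean_windows n (Suc (Suc i))"
    define k where "k = real i"
    define x where "x = real n"
    have ih1: "2 * (k + 1) * (x - k) * a = (2 * x + 1 - k) * (k + 2) * b"
      using Suc.IH[of i] by (simp add: a_def b_def k_def x_def)
    have ih2: "2 * (k + 2) * (x - k - 1) * b = (2 * x - k) * (k + 3) * c"
      using Suc.IH[of "Suc i"] by (simp add: c_def b_def k_def x_def algebra_simps)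
    have r1: "?N * mean_windows (Suc n) j = (2 * x + 1 - k) * b + (k + 1) * a"
      using mean_windows_Suc_Suc[of n i] Suc by (simp add: a_def b_def k_def x_def)
    have r2: "?N * mean_windows (Suc n) (Suc j) = (2 * x - k) * c + (k + 2) * b"
      using mean_windows_Suc_Suc[of n "Suc i"] Suc by (simp add: b_def c_def k_def x_def algebra_simps)
    \<comment> \<open>By \<open>ih1\<close> and \<open>ih2\<close> both sides equal
      \<open>(k + 2) * (2 * x + 1 - k) * (2 * x + 2 - k) * b\<close>.\<close>
    have "2 * (k + 2) * (x - k) * ((2 * x + 1 - k) * b + (k + 1) * a)
        = (2 * x + 2 - k) * (k + 3) * ((2 * x - k) * c + (k + 2) * b)"
      using ih1 ih2 by algebra
    hence "?N * (2 * (k + 2) * (x - k) * mean_windows (Suc n) j)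
        = ?N * ((2 * x + 2 - k) * (k + 3) * mean_windows (Suc n) (Suc j))"
      using r1 r2 by (metis mult.left_commute)
    moreover have "?N \<noteq> 0" by linarith
    ultimately have "2 * (k + 2) * (x - k) * mean_windows (Suc n) j
        = (2 * x + 2 - k) * (k + 3) * mean_windows (Suc n) (Suc j)"
      by (metis mult_left_cancel)
    thus ?thesis using Suc by (simp add: k_def x_def algebra_simps)
  qed
qed

lemma mean_windows_nonneg: "0 \<le> mean_windows n j"
proof (induction j)
  case (Suc j)
  show ?case
  proof (cases "j < n")
    case True
    have "0 \<le> (2 * real n + 1 - real j) * (real j + 2) * mean_windows n (Suc j)"
      unfolding mean_windows_ratio[symmetric] using True Suc.IH by simp
    moreover have "0 < (2 * real n + 1 - real j) * (real j + 2)"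
      using True by (intro mult_pos_pos) auto
    ultimately show ?thesis by (simp add: zero_le_mult_iff)
  qed (simp add: mean_windows_eq_0)
qed auto

text \<open>In \<open>mean_windows_ratio\<close> the factor \<open>2 * (n - j)\<close> is at most
  \<open>2 * n + 1 - j\<close>.\<close>

lemma mean_windows_step: "(real j + 2) * mean_windows n (Suc j) \<le> (real j + 1) * mean_windows n j"
proof (cases "j < n")
  case True
  define c where "c = 2 * real n + 1 - real j"
  have "c > 0" using True by (simp add: c_def)
  have "c * ((real j + 2) * mean_windows n (Suc j)) = 2 * (real n - real j) * ((real j + 1) * mean_windows n j)"
    using mean_windows_ratio[of j n] by (simp add: c_def algebra_simps)
  also have "\<dots> \<le> c * ((real j + 1) * mean_windows n j)"
    by (intro mult_right_mono mult_nonneg_nonneg mean_windows_nonneg) (auto simp: c_def)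
  finally show ?thesis using \<open>c > 0\<close> by simp
qed (simp add: mean_windows_eq_0 mean_windows_nonneg)

lemma mean_windows_antimono: "mean_windows n (Suc j) \<le> mean_windows n j"
proof -
  have "(real j + 1) * mean_windows n (Suc j) \<le> (real j + 2) * mean_windows n (Suc j)"
    by (intro mult_right_mono mean_windows_nonneg) auto
  also note mean_windows_step
  finally show ?thesis by (simp add: mult_le_cancel_left_pos)
qed

lemma mean_windows_le: "(real j + 1) * mean_windows n j \<le> 2 * real n + 1"
proof (induction j)
  case (Suc j)
  thus ?case using mean_windows_step[of j n] by (simp add: algebra_simps)
qed simp

text \<open>By \<open>mean_windows_ratio\<close>, the quotient of consecutive terms tends to
  \<open>(j + 1) / (j + 2)\<close>, and these limits multiply up to
  \<open>1 / (j + 1)\<close>.\<close>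

lemma mean_windows_limit: "(\<lambda>n. mean_windows n j / (2 * real n + 1)) \<longlonglongrightarrow> 1 / (real j + 1)"
proof (induction j)
  case 0
  have "2 * real n + 1 \<noteq> 0" for n by linarith
  thus ?case by simp
next
  case (Suc j)
  have "(\<lambda>n. 2 * (real j + 1) * (real n - real j) / ((2 * real n + 1 - real j) * (real j + 2)))
          \<longlonglongrightarrow> (real j + 1) / (real j + 2)"
    by (real_asymp simp: field_simps)
  from tendsto_mult[OF this Suc.IH]
  have "(\<lambda>n. 2 * (real j + 1) * (real n - real j) / ((2 * real n + 1 - real j) * (real j + 2)) *
          (mean_windows n j / (2 * real n + 1))) \<longlonglongrightarrow> 1 / (real (Suc j) + 1)"
    by (simp add: add_ac)
  moreover have "\<forall>\<^sub>F n in sequentially.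
      2 * (real j + 1) * (real n - real j) / ((2 * real n + 1 - real j) * (real j + 2)) *
          (mean_windows n j / (2 * real n + 1)) = mean_windows n (Suc j) / (2 * real n + 1)"
    using eventually_ge_at_top[of j]
  proof eventually_elim
    case (elim n)
    have "2 * real n + 1 - real j \<noteq> 0" "real j + 2 \<noteq> 0" using elim by auto
    hence "2 * (real j + 1) * (real n - real j) / ((2 * real n + 1 - real j) * (real j + 2)) *
       mean_windows n j = mean_windows n (Suc j)"
      unfolding times_divide_eq_left mean_windows_ratio by simp
    thus ?case by (metis times_divide_eq_right)
  qed
  ultimately show ?case by (rule Lim_transform_eventually)
qed

section \<open>The alternating sum of the means and its limit\<close>

definition mean_first_starts :: "nat \<Rightarrow> real" where
  "mean_first_starts n = (\<Sum>j<n. (- 1) ^ j * mean_windows n (Suc j))"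

lemma alternating_sum_bounds:
  fixes a :: "nat \<Rightarrow> real"
  assumes "\<And>i. 0 \<le> a i" and "\<And>i. a (Suc i) \<le> a i"
  shows "0 \<le> (\<Sum>i<m. (- 1) ^ i * a i) \<and> (\<Sum>i<m. (- 1) ^ i * a i) \<le> a 0"
  using assms
proof (induction m arbitrary: a)
  case (Suc m)
  have "0 \<le> (\<Sum>i<m. (- 1) ^ i * a (Suc i)) \<and> (\<Sum>i<m. (- 1) ^ i * a (Suc i)) \<le> a (Suc 0)"
    by (rule Suc.IH[of "\<lambda>i. a (Suc i)"]) (use Suc.prems in auto)
  moreover have "(\<Sum>i<Suc m. (- 1) ^ i * a i) = a 0 - (\<Sum>i<m. (- 1) ^ i * a (Suc i))"
    by (subst sum.lessThan_Suc_shift) (simp add: sum_negf)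
  ultimately show ?case using Suc.prems(2)[of 0] by auto
qed simp

text \<open>Leibniz estimate: up to sign the tail is again an alternating sum with decreasing
  terms.\<close>

lemma mean_first_starts_tail:
  "\<bar>mean_first_starts n - (\<Sum>j<J. (- 1) ^ j * mean_windows n (Suc j))\<bar> \<le> mean_windows n (Suc J)"
proof (cases "J \<le> n")
  case True
  have "mean_first_starts n = (\<Sum>j<J. (- 1) ^ j * mean_windows n (Suc j))
      + (\<Sum>j=J..<n. (- 1) ^ j * mean_windows n (Suc j))"
    unfolding mean_first_starts_def lessThan_atLeast0
    using True by (simp add: sum.atLeastLessThan_concat)
  also have "(\<Sum>j=J..<n. (- 1) ^ j * mean_windows n (Suc j))
      = (\<Sum>i<n - J. (- 1) ^ (i + J) * mean_windows n (Suc (i + J)))"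
    using True sum.shift_bounds_nat_ivl[of "\<lambda>j. (- 1) ^ j * mean_windows n (Suc j)" 0 J "n - J"]
    by (simp add: lessThan_atLeast0)
  also have "\<dots> = (- 1) ^ J * (\<Sum>i<n - J. (- 1) ^ i * mean_windows n (Suc (i + J)))"
    by (simp add: sum_distrib_left power_add mult_ac)
  finally have "\<bar>mean_first_starts n - (\<Sum>j<J. (- 1) ^ j * mean_windows n (Suc j))\<bar>
      = \<bar>\<Sum>i<n - J. (- 1) ^ i * mean_windows n (Suc (i + J))\<bar>"
    by (simp add: abs_mult power_abs)
  also have "\<dots> \<le> mean_windows n (Suc J)"
    using alternating_sum_bounds[of "\<lambda>i. mean_windows n (Suc (i + J))" "n - J"]
    by (simp add: mean_windows_nonneg mean_windows_antimono)
  finally show ?thesis .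
next
  case False
  have "(\<Sum>j<J. (- 1) ^ j * mean_windows n (Suc j)) = mean_first_starts n"
    unfolding mean_first_starts_def using False
    by (intro sum.mono_neutral_right) (auto simp: mean_windows_eq_0)
  thus ?thesis by (simp add: mean_windows_nonneg)
qed


text \<open>
  The factor \<open>2n + 1\<close> is a solution of the homogeneous second-order recurrence of
  \<open>mean_first_starts\<close>; dividing by it leaves a first-order recurrence for the differences.
\<close>

definition scaled_mean :: "nat \<Rightarrow> real" where
  "scaled_mean n = mean_first_starts n / (2 * real n + 1)"

lemma sums_one_minus_ln2: "(\<lambda>j. (- 1) ^ j / (real j + 2)) sums (1 - ln 2)"
proof -
  have "(\<lambda>k. (- 1) ^ Suc k / real (Suc (Suc k))) sums (ln 2 - 1)"
    using alternating_harmonic_series_sums sums_Suc_iff[of "\<lambda>k. (- 1) ^ k / real (Suc k)" "ln 2 - 1"]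
    by simp
  from sums_minus[OF this] show ?thesis by (simp add: add_ac)
qed

text \<open>Each term converges, and truncation at \<open>J\<close> costs at most
  \<open>1 / (J + 2)\<close> uniformly in \<open>n\<close>, so limit and alternating sum may be
  exchanged.\<close>

lemma scaled_mean_limit: "scaled_mean \<longlonglongrightarrow> 1 - ln 2"
proof (rule LIMSEQ_I)
  fix e :: real assume "e > 0"
  define P :: "nat \<Rightarrow> real" where "P = (\<lambda>J. \<Sum>j<J. (- 1) ^ j / (real j + 2))"
  define Q where "Q J n = (\<Sum>j<J. (- 1) ^ j * mean_windows n (Suc j) / (2 * real n + 1))" for J n
  have "P \<longlonglongrightarrow> 1 - ln 2"
    using sums_one_minus_ln2 unfolding sums_def P_def .
  hence "\<forall>\<^sub>F J in sequentially. \<bar>P J - (1 - ln 2)\<bar> < e / 3"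
    using tendstoD[of _ _ _ "e / 3"] \<open>e > 0\<close> by (simp only: flip: dist_real_def) simp
  moreover have "(\<lambda>J. 1 / (real J + 2)) \<longlonglongrightarrow> 0"
    by real_asymp
  hence "\<forall>\<^sub>F J in sequentially. 1 / (real J + 2) < e / 3"
    using \<open>e > 0\<close> by (intro order_tendstoD) auto
  ultimately obtain J where J: "\<bar>P J - (1 - ln 2)\<bar> < e / 3" "1 / (real J + 2) < e / 3"
    by (metis (mono_tags, lifting) eventually_conj eventually_happens' sequentially_bot)
  have tail: "\<bar>scaled_mean n - Q J n\<bar> \<le> 1 / (real J + 2)" for n
  proof -
    have "scaled_mean n - Q J n
        = (mean_first_starts n - (\<Sum>j<J. (- 1) ^ j * mean_windows n (Suc j))) / (2 * real n + 1)"
      by (simp add: scaled_mean_def Q_def diff_divide_distrib flip: sum_divide_distrib)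
    hence "\<bar>scaled_mean n - Q J n\<bar>
        = \<bar>mean_first_starts n - (\<Sum>j<J. (- 1) ^ j * mean_windows n (Suc j))\<bar> / (2 * real n + 1)"
      by (simp add: abs_divide)
    also have "\<dots> \<le> mean_windows n (Suc J) / (2 * real n + 1)"
      by (intro divide_right_mono mean_first_starts_tail) auto
    also have "\<dots> \<le> 1 / (real J + 2)"
      using mean_windows_le[of "Suc J" n] by (simp add: divide_simps mult_ac add_ac)
    finally show ?thesis .
  qed
  have "Q J \<longlonglongrightarrow> P J"
    unfolding Q_def P_def
  proof (intro tendsto_sum)
    fix j
    have "(\<lambda>n. (- 1) ^ j * (mean_windows n (Suc j) / (2 * real n + 1)))
        \<longlonglongrightarrow> (- 1) ^ j * (1 / (real (Suc j) + 1))"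
      by (intro tendsto_mult tendsto_const mean_windows_limit)
    thus "(\<lambda>n. (- 1) ^ j * mean_windows n (Suc j) / (2 * real n + 1)) \<longlonglongrightarrow> (- 1) ^ j / (real j + 2)"
      by (simp add: add_ac)
  qed
  hence "\<forall>\<^sub>F n in sequentially. \<bar>Q J n - P J\<bar> < e / 3"
    using tendstoD[of _ _ _ "e / 3"] \<open>e > 0\<close> by (simp only: flip: dist_real_def) simp
  then obtain N where N: "\<bar>Q J n - P J\<bar> < e / 3" if "n \<ge> N" for n
    by (auto simp: eventually_sequentially)
  show "\<exists>N. \<forall>n\<ge>N. norm (scaled_mean n - (1 - ln 2)) < e"
  proof (intro exI allI impI)
    fix n assume "n \<ge> N"
    thus "norm (scaled_mean n - (1 - ln 2)) < e"
      using N[of n] tail[of n] J unfolding real_norm_def by linarith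
  qed
qed

section \<open>Differences of the scaled mean: recurrence and rate of convergence\<close>

definition weighted_sum :: "nat \<Rightarrow> (nat \<Rightarrow> real) \<Rightarrow> real" where
  "weighted_sum n p = (\<Sum>j\<le>n. (- 1) ^ j * (p j * mean_windows n j))"

lemma weighted_sum_atMost:
  "n \<le> m \<Longrightarrow> (\<Sum>j\<le>m. (- 1) ^ j * (p j * mean_windows n j)) = weighted_sum n p"
  unfolding weighted_sum_def
  by (rule sum.mono_neutral_right) (auto simp: mean_windows_eq_0)

text \<open>Shifting the index flips the sign and splits off the term at 0. The value
  \<open>p' 0\<close> is free, so a polynomial weight can be continued to 0 by its own
  formula.\<close>

lemma weighted_sum_shift:
  "n \<le> m \<Longrightarrow> (\<Sum>j\<le>m. (- 1) ^ j * (p j * mean_windows n (Suc j))) =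
     p' 0 * (2 * real n + 1) - weighted_sum n p'" if "\<And>j. p' (Suc j) = p j"
  using weighted_sum_atMost[of n "Suc m" p'] that
  by (simp add: sum.atMost_Suc_shift sum_negf del: sum.atMost_Suc)

text \<open>
  By \<open>mean_windows_ratio\<close>, the summand is the sum of consecutive values of
  \<open>(j + 1) (2n + 2 - j) mean_windows n j\<close>.
\<close>

lemma weighted_sum_telescope:
  "weighted_sum n (\<lambda>j. (real j + 1) * (4 * real n + 2 - 3 * real j)) = (2 * real n + 1) * (2 * real n + 2)"
proof -
  let ?p = "\<lambda>j. (real j + 1) * (2 * real n + 2 - real j)"
  have "weighted_sum n (\<lambda>j. 2 * (real j + 1) * (real n - real j))
      = (\<Sum>j\<le>n. (- 1) ^ j * ((real j + 2) * (2 * real n + 1 - real j) * mean_windows n (Suc j)))"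
    unfolding weighted_sum_def mean_windows_ratio by (simp add: mult_ac)
  also have "\<dots> = ?p 0 * (2 * real n + 1) - weighted_sum n ?p"
    by (rule weighted_sum_shift) (auto simp: algebra_simps)
  finally have "weighted_sum n (\<lambda>j. 2 * (real j + 1) * (real n - real j)) + weighted_sum n ?p
      = (2 * real n + 1) * (2 * real n + 2)"
    by (simp add: mult_ac)
  moreover have "weighted_sum n (\<lambda>j. 2 * (real j + 1) * (real n - real j)) + weighted_sum n ?p
     = weighted_sum n (\<lambda>j. (real j + 1) * (4 * real n + 2 - 3 * real j))"
    unfolding weighted_sum_def sum.distrib[symmetric]
    by (intro sum.cong refl) (simp add: algebra_simps)
  ultimately show ?thesis by simp
qed

text \<open>By \<open>scaled_mean_Suc\<close>, the increment of \<open>scaled_mean\<close> freed of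
  its denominator.\<close>

definition deviation :: "nat \<Rightarrow> real" where
  "deviation n = 2 * weighted_sum n (\<lambda>j. real j + 1) - (2 * real n + 1)"

lemma deviation_0: "deviation 0 = 1"
  by (simp add: deviation_def weighted_sum_def)

text \<open>The recursion for \<open>mean_windows\<close> expresses the sum with weight
  \<open>j + 1\<close> for \<open>n + 1\<close> by \<open>W\<close> and \<open>V\<close> for
  \<open>n\<close>; the telescoping identity then eliminates \<open>V\<close>.\<close>

lemma deviation_Suc:
  "3 * (2 * real n + 1) * deviation (Suc n) = 2 * real n + 1 - (2 * real n + 4) * deviation n"
proof -
  define x where "x = real n"
  define W where "W = weighted_sum n (\<lambda>j. real j + 1)"
  define V where "V = weighted_sum n (\<lambda>j. (real j + 1) * real j)"
  let ?q = "\<lambda>j. (real j + 1) * (2 * x + 2 - real j)"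
  have lin: "weighted_sum n (\<lambda>j. c * (real j + 1) + d * ((real j + 1) * real j)) = c * W + d * V" for c d
    unfolding W_def V_def weighted_sum_def sum_distrib_left sum.distrib[symmetric]
    by (intro sum.cong refl) (simp add: algebra_simps)
  \<comment> \<open>The term at 0 is \<open>2 * x + 3\<close>; removing it leaves indices
    \<open>Suc j\<close>, to which the recursion applies.\<close>
  have "(2 * x + 1) * (2 * x + 3 - weighted_sum (Suc n) (\<lambda>j. real j + 1))
      = (\<Sum>j\<le>n. (- 1) ^ j * ((real j + 2) * ((2 * x + 1) * mean_windows (Suc n) (Suc j))))"
    unfolding weighted_sum_def sum.atMost_Suc_shift
    by (simp add: x_def sum_negf sum_distrib_left mult_ac add_ac)
  also have "\<dots> = (\<Sum>j\<le>n. (- 1) ^ j * ((real j + 2) * (2 * x + 1 - real j) * mean_windows n (Suc j)))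
      + (\<Sum>j\<le>n. (- 1) ^ j * ((real j + 2) * (real j + 1) * mean_windows n j))"
    unfolding x_def mean_windows_Suc_Suc sum.distrib[symmetric]
    by (intro sum.cong refl) (simp add: algebra_simps)
  also have "(\<Sum>j\<le>n. (- 1) ^ j * ((real j + 2) * (2 * x + 1 - real j) * mean_windows n (Suc j)))
      = ?q 0 * (2 * real n + 1) - weighted_sum n ?q"
    by (rule weighted_sum_shift) (auto simp: algebra_simps)
  also have "weighted_sum n ?q = (2 * x + 2) * W - V"
    using lin[of "2 * x + 2" "- 1"] by (simp add: algebra_simps)
  also have "(\<Sum>j\<le>n. (- 1) ^ j * ((real j + 2) * (real j + 1) * mean_windows n j)) = 2 * W + V"
    using lin[of 2 1] unfolding weighted_sum_def by (simp add: algebra_simps)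
  finally have 1: "(2 * x + 1) * (2 * x + 3 - weighted_sum (Suc n) (\<lambda>j. real j + 1))
      = (2 * x + 2) * (2 * x + 1) - 2 * x * W + 2 * V"
    by (simp add: x_def algebra_simps)
  have 2: "(4 * x + 2) * W - 3 * V = (2 * x + 1) * (2 * x + 2)"
    using weighted_sum_telescope[of n] lin[of "4 * x + 2" "- 3"] by (simp add: x_def algebra_simps)
  have d: "deviation n = 2 * W - (2 * x + 1)"
    "deviation (Suc n) = 2 * weighted_sum (Suc n) (\<lambda>j. real j + 1) - (2 * x + 3)"
    by (simp_all add: deviation_def W_def x_def)
  show ?thesis
    unfolding d x_def[symmetric] using 1 2 by algebra
qed

text \<open>After cross-multiplication the coefficient of \<open>mean_windows n (Suc j)\<close> is
  \<open>(2n + 1 - j) - (2n + 3) = - (j + 2)\<close>, so an index shift turns this part into a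
  second sum with weight \<open>j + 1\<close>.\<close>

lemma scaled_mean_Suc:
  "scaled_mean (Suc n) - scaled_mean n = deviation n / ((2 * real n + 1) * (2 * real n + 3))"
proof -
  define x where "x = real n"
  have ext: "mean_first_starts n = (\<Sum>j\<le>n. (- 1) ^ j * mean_windows n (Suc j))"
    by (simp add: mean_first_starts_def mean_windows_eq_0 flip: lessThan_Suc_atMost)
  have "(2 * x + 1) * mean_first_starts (Suc n) - (2 * x + 3) * mean_first_starts n
      = (\<Sum>j\<le>n. (- 1) ^ j * ((2 * x + 1) * mean_windows (Suc n) (Suc j)))
        - (\<Sum>j\<le>n. (- 1) ^ j * ((2 * x + 3) * mean_windows n (Suc j)))"
    unfolding mean_first_starts_def[of "Suc n"] ext lessThan_Suc_atMost sum_distrib_left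
    by (simp only: mult.left_commute)
  also have "\<dots> = weighted_sum n (\<lambda>j. real j + 1)
      - (\<Sum>j\<le>n. (- 1) ^ j * ((real j + 2) * mean_windows n (Suc j)))"
    unfolding x_def mean_windows_Suc_Suc weighted_sum_def sum_subtractf[symmetric]
    by (intro sum.cong refl) (simp add: algebra_simps)
  also have "(\<Sum>j\<le>n. (- 1) ^ j * ((real j + 2) * mean_windows n (Suc j)))
     = (real 0 + 1) * (2 * real n + 1) - weighted_sum n (\<lambda>j. real j + 1)"
    by (rule weighted_sum_shift) auto
  finally have "(2 * x + 1) * mean_first_starts (Suc n) - (2 * x + 3) * mean_first_starts n = deviation n"
    by (simp add: deviation_def)
  moreover have "2 * x + 1 \<noteq> 0" "2 * x + 3 \<noteq> 0" by (simp_all add: x_def; linarith)+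
  ultimately show ?thesis
    unfolding scaled_mean_def x_def by (simp add: field_simps)
qed

text \<open>For large \<open>n\<close> the recurrence is close to \<open>3 b' = 1 - b\<close>, with
  fixed point \<open>1/4\<close> and factor \<open>-1/3\<close>. The perturbation is of order
  \<open>1/n\<close>, so a bound \<open>C / (2n + 1)\<close> reproduces itself; \<open>C = 4\<close>
  suffices from \<open>n = 3\<close> on.\<close>

lemma deviation_bound:
  "3 \<le> n \<Longrightarrow> \<bar>deviation n - 1 / 4\<bar> \<le> 4 / (2 * real n + 1)"
proof (induction n rule: dec_induct)
  case base
  have "deviation 1 = - 1" using deviation_Suc[of 0] by (simp add: deviation_0)
  moreover have "deviation 2 = 1"
    using deviation_Suc[of 1] calculation by (simp add: numeral_2_eq_2)
  moreover have "deviation 3 = - 1 / 5"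
    using deviation_Suc[of 2] calculation by (simp add: numeral_3_eq_3 numeral_2_eq_2)
  ultimately show ?case by simp
next
  case (step n)
  define x where "x = real n"
  define e where "e = deviation n - 1 / 4"
  have x: "x \<ge> 3" using step.hyps by (simp add: x_def)
  have "3 * (2 * x + 1) * (deviation (Suc n) - 1 / 4) = - 3 / 4 - (2 * x + 4) * e"
    using deviation_Suc[of n] by (simp add: x_def e_def algebra_simps)
  hence "\<bar>3 * (2 * x + 1) * (deviation (Suc n) - 1 / 4)\<bar> = \<bar>3 / 4 + (2 * x + 4) * e\<bar>"
    by linarith
  hence "3 * (2 * x + 1) * \<bar>deviation (Suc n) - 1 / 4\<bar> = \<bar>3 / 4 + (2 * x + 4) * e\<bar>"
    using x by (simp only: abs_mult)
  also have "\<dots> \<le> 3 / 4 + (2 * x + 4) * \<bar>e\<bar>"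
    using x by (simp add: abs_mult order.trans[OF abs_triangle_ineq])
  also have "\<dots> \<le> 3 / 4 + (2 * x + 4) * (4 / (2 * x + 1))"
    using x step.IH by (intro add_left_mono mult_left_mono) (auto simp: x_def e_def)
  also have "\<dots> \<le> 3 * (2 * x + 1) * (4 / (2 * x + 3))"
  proof -
    define y where "y = 2 * x + 1"
    have y: "y \<ge> 7" using x by (simp add: y_def)
    have "y * y \<ge> 7 * y" using y by (intro mult_right_mono) auto
    \<comment> \<open>The wanted inequality multiplied by \<open>4 * y * (y + 2)\<close>.\<close>
    hence "19 * (y * y) + 86 * y + 96 \<le> 48 * (y * y)" using y by linarith
    hence "3 / 4 + (y + 3) * (4 / y) \<le> 3 * y * (4 / (y + 2))"
      using y by (simp add: divide_simps) (simp add: algebra_simps)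
    thus ?thesis by (simp add: y_def add_ac)
  qed
  finally have "\<bar>deviation (Suc n) - 1 / 4\<bar> \<le> 4 / (2 * x + 3)"
    by (rule mult_left_le_imp_le) (use x in simp)
  thus ?case
    by (simp add: x_def add_ac)
qed

text \<open>The limit \<open>1/4\<close> of \<open>deviation\<close> contributes increments
  \<open>(1/8) * (1 / (2n + 1) - 1 / (2n + 3))\<close>, which the correction term in
  \<open>h\<close> cancels. What remains is dominated by the decrements of \<open>r\<close>, so
  \<open>h + r\<close> decreases and \<open>h - r\<close> increases to the common limit.\<close>

lemma scaled_mean_error:
  assumes "3 \<le> n"
  shows "\<bar>scaled_mean n + 1 / (8 * (2 * real n + 1)) - (1 - ln 2)\<bar> \<le> 2 / (2 * real n + 1)\<^sup>2"
proof -
  define h where "h = (\<lambda>n. scaled_mean n + 1 / (8 * (2 * real n + 1)))"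
  define r where "r = (\<lambda>n. 2 / (2 * real n + 1)\<^sup>2)"
  have h: "h \<longlonglongrightarrow> 1 - ln 2"
  proof -
    have "(\<lambda>n. 1 / (8 * (2 * real n + 1))) \<longlonglongrightarrow> 0" by real_asymp
    from tendsto_add[OF scaled_mean_limit this] show ?thesis unfolding h_def by simp
  qed
  have r: "r \<longlonglongrightarrow> 0" unfolding r_def by real_asymp
  have step: "\<bar>h (Suc n) - h n\<bar> \<le> r n - r (Suc n)" if "3 \<le> n" for n
  proof -
    define x where "x = real n"
    have x: "x \<ge> 3" using that by (simp add: x_def)
    have "h (Suc n) - h n = deviation n / ((2 * x + 1) * (2 * x + 3)) + 1 / (8 * (2 * x + 3)) - 1 / (8 * (2 * x + 1))"
      using scaled_mean_Suc[of n] by (simp add: h_def x_def add_ac)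
    also have "\<dots> = (deviation n - 1 / 4) / ((2 * x + 1) * (2 * x + 3))"
      using x by (simp add: divide_simps) (simp add: algebra_simps)
    finally have "\<bar>h (Suc n) - h n\<bar> = \<bar>deviation n - 1 / 4\<bar> / ((2 * x + 1) * (2 * x + 3))"
      using x by (simp add: abs_divide abs_mult)
    also have "\<dots> \<le> 4 / (2 * x + 1) / ((2 * x + 1) * (2 * x + 3))"
      using x deviation_bound[OF that] by (intro divide_right_mono) (auto simp: x_def)
    also have "\<dots> \<le> 2 / (2 * x + 1)\<^sup>2 - 2 / (2 * x + 3)\<^sup>2"
    proof -
      define y where "y = 2 * x + 1"
      have y: "y \<ge> 7" using x by (simp add: y_def)
      have "2 / y\<^sup>2 - 2 / (y + 2)\<^sup>2 - 4 / y / (y * (y + 2)) = 4 * y / (y\<^sup>2 * (y + 2)\<^sup>2)"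
        using y by (simp add: divide_simps) (simp add: power2_eq_square algebra_simps)
      also have "\<dots> \<ge> 0" using y by simp
      finally show ?thesis by (simp add: y_def add_ac)
    qed
    also have "\<dots> = r n - r (Suc n)"
      by (simp add: r_def x_def add_ac)
    finally show ?thesis .
  qed
  have "h n + r n \<ge> 1 - ln 2"
  proof (rule LIMSEQ_le_const2)
    show "(\<lambda>n. h n + r n) \<longlonglongrightarrow> 1 - ln 2" using tendsto_add[OF h r] by simp
    have "h m + r m \<le> h n + r n" if "n \<le> m" for m
      using that by (induction m rule: dec_induct) (use step assms in \<open>smt (verit) le_trans\<close>)+
    thus "\<exists>N. \<forall>m\<ge>N. h m + r m \<le> h n + r n" by blast
  qed
  moreover have "h n - r n \<le> 1 - ln 2"
  proof (rule LIMSEQ_le_const)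
    show "(\<lambda>n. h n - r n) \<longlonglongrightarrow> 1 - ln 2" using tendsto_diff[OF h r] by simp
    have "h n - r n \<le> h m - r m" if "n \<le> m" for m
      using that by (induction m rule: dec_induct) (use step assms in \<open>smt (verit) le_trans\<close>)+
    thus "\<exists>N. \<forall>m\<ge>N. h n - r n \<le> h m - r m" by blast
  qed
  ultimately show ?thesis unfolding h_def r_def by linarith
qed

lemma scaled_mean_second_order:
  "(\<lambda>n. (2 * real n + 1) * (scaled_mean n - (1 - ln 2)) + 1 / 8) \<longlonglongrightarrow> 0"
proof (rule Lim_null_comparison)
  show "(\<lambda>n. 2 / (2 * real n + 1)) \<longlonglongrightarrow> 0" by real_asymp
  show "\<forall>\<^sub>F n in sequentially. norm ((2 * real n + 1) * (scaled_mean n - (1 - ln 2)) + 1 / 8) \<le> 2 / (2 * real n + 1)"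
    using eventually_ge_at_top[of 3]
  proof eventually_elim
    case (elim n)
    let ?y = "2 * real n + 1"
    have y: "?y > 0" by linarith
    have "y * (s - l) + 1 / 8 = y * (s + 1 / (8 * y) - l)" if "y > 0" for y s l :: real
      using that by (simp add: field_simps)
    from this[OF y] have "norm (?y * (scaled_mean n - (1 - ln 2)) + 1 / 8)
        = \<bar>?y * (scaled_mean n + 1 / (8 * ?y) - (1 - ln 2))\<bar>"
      by simp
    also have "\<dots> = ?y * \<bar>scaled_mean n + 1 / (8 * ?y) - (1 - ln 2)\<bar>"
      using y by (simp add: abs_mult)
    also have "\<dots> \<le> ?y * (2 / ?y\<^sup>2)"
      using y by (intro mult_left_mono scaled_mean_error elim) auto
    also have "\<dots> = 2 / ?y"
      unfolding power2_eq_square using y by (simp only: times_divide_eq_right mult_divide_mult_cancel_left_if) simp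
    finally show ?case .
  qed
qed

subsection \<open>Random decks\<close>

text \<open>Arbitrary sets of numbers are allowed because removing a pair destroys the form
  \<open>{1..n}\<close>.\<close>

definition decks_of :: "nat set \<Rightarrow> nat list set" where
  "decks_of A = permutations_of_multiset (repeat_mset 2 (mset_set A))"

lemma count_deck:
  assumes "d \<in> decks_of A" "finite A"
  shows "count (mset d) x = (if x \<in> A then 2 else 0)"
proof -
  have "mset d = repeat_mset 2 (mset_set A)"
    using assms by (auto simp: decks_of_def permutations_of_multiset_def)
  thus ?thesis using assms by (simp add: count_mset_set')
qed

lemma in_decks_of_iff:
  assumes "finite A"
  shows "d \<in> decks_of A \<longleftrightarrow> (\<forall>x. count (mset d) x = (if x \<in> A then 2 else 0))"
  using assms by (auto simp: decks_of_def permutations_of_multiset_def multiset_eq_iff count_mset_set')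

lemma set_deck: "d \<in> decks_of A \<Longrightarrow> finite A \<Longrightarrow> set d = A"
  using count_deck[of d A] by (metis (mono_tags, lifting) count_mset_0_iff subsetI subset_antisym zero_neq_numeral)

lemma length_deck:
  assumes "d \<in> decks_of A"
  shows "length d = 2 * card A"
proof -
  have "mset d = repeat_mset 2 (mset_set A)"
    using assms by (auto simp: decks_of_def permutations_of_multiset_def)
  from arg_cong[OF this, of size] show ?thesis by simp
qed

lemma finite_decks_of [simp]: "finite (decks_of A)"
  by (simp add: decks_of_def)

lemma decks_of_nonempty [simp]: "decks_of A \<noteq> {}"
  by (simp add: decks_of_def)

lemma decks_of_empty: "decks_of {} = {[]}"
  by (simp add: decks_of_def)

section \<open>Generating decks by insertion of a pair\<close>

definition insert_pair_last :: "nat \<Rightarrow> nat \<Rightarrow> nat list \<Rightarrow> nat list" where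
  "insert_pair_last a p d = take p d @ a # drop p d @ [a]"

definition insert_pair_adjacent :: "nat \<Rightarrow> nat \<Rightarrow> nat list \<Rightarrow> nat list" where
  "insert_pair_adjacent a p d = take p d @ a # a # drop p d"

lemma count_take_drop: "count (mset (take p d)) x + count (mset (drop p d)) x = count (mset d) x"
  by (metis append_take_drop_id count_union mset_append)

lemma insert_pair_last_deck:
  assumes "finite A" "a \<in> A" "d \<in> decks_of (A - {a})"
  shows "insert_pair_last a p d \<in> decks_of A"
  using assms count_deck[OF assms(3)] count_take_drop[of p d]
  by (auto simp: in_decks_of_iff insert_pair_last_def split: if_splits)

lemma insert_pair_adjacent_deck:
  assumes "finite A" "a \<in> A" "d \<in> decks_of (A - {a})"
  shows "insert_pair_adjacent a p d \<in> decks_of A"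
  using assms count_deck[OF assms(3)] count_take_drop[of p d]
  by (auto simp: in_decks_of_iff insert_pair_adjacent_def split: if_splits)

text \<open>The first occurrence of \<open>a\<close> marks the place of insertion.\<close>

lemma split_unique:
  assumes "take p d @ a # xs = take q e @ a # ys" "a \<notin> set d" "a \<notin> set e" "p \<le> length d" "q \<le> length e"
  shows "p = q \<and> take p d = take q e \<and> xs = ys"
proof -
  have "a \<notin> set (take p d)" "a \<notin> set (take q e)"
    using assms by (auto dest: in_set_takeD)
  hence "takeWhile (\<lambda>x. x \<noteq> a) (take p d @ a # xs) = take p d"
    "takeWhile (\<lambda>x. x \<noteq> a) (take q e @ a # ys) = take q e"
    by (subst takeWhile_append2; force)+
  hence "take p d = take q e \<and> xs = ys"
    using assms(1) by simp
  moreover have "p = q"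
    using calculation assms(4,5) by (metis length_take min.absorb2)
  ultimately show ?thesis by simp
qed

text \<open>Every deck arises exactly once: its last card is \<open>a\<close>, the earlier copy of
  \<open>a\<close> gives \<open>p\<close>, and deleting both gives \<open>d\<close>.\<close>

lemma sum_decks_last:
  fixes f :: "nat list \<Rightarrow> real"
  assumes "finite A" "card A = Suc n"
  shows "(\<Sum>d\<in>decks_of A. f d) =
    (\<Sum>a\<in>A. \<Sum>d\<in>decks_of (A - {a}). \<Sum>p\<le>2 * n. f (insert_pair_last a p d))"
proof -
  let ?S = "SIGMA a:A. decks_of (A - {a}) \<times> {..2 * n}"
  have len: "length d = 2 * n" "a \<notin> set d" if "a \<in> A" "d \<in> decks_of (A - {a})" for a d
    using length_deck[OF that(2)] set_deck[OF that(2)] assms that(1) by auto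
  have "bij_betw (\<lambda>(a, d, p). insert_pair_last a p d) ?S (decks_of A)"
    unfolding bij_betw_def
  proof
    show "inj_on (\<lambda>(a, d, p). insert_pair_last a p d) ?S"
    proof (rule inj_onI, clarsimp)
      fix a d p b e q
      assume *: "a \<in> A" "d \<in> decks_of (A - {a})" "b \<in> A" "e \<in> decks_of (A - {b})"
        "p \<le> 2 * n" "q \<le> 2 * n" "insert_pair_last a p d = insert_pair_last b q e"
      have ab: "a = b" using arg_cong[OF *(7), of last] by (simp add: insert_pair_last_def)
      have "p = q \<and> take p d = take q e \<and> drop p d @ [a] = drop q e @ [a]"
        using * len[OF *(1,2)] len[OF *(3,4)] ab
        by (intro split_unique[where a = a]) (auto simp: insert_pair_last_def)
      thus "a = b \<and> d = e \<and> p = q"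
        using ab by (metis append_take_drop_id append_same_eq)
    qed
    show "(\<lambda>(a, d, p). insert_pair_last a p d) ` ?S = decks_of A"
    proof (intro equalityI subsetI)
      fix d assume "d \<in> (\<lambda>(a, d, p). insert_pair_last a p d) ` ?S"
      thus "d \<in> decks_of A" using insert_pair_last_deck[OF assms(1)] by auto
    next
      fix d assume d: "d \<in> decks_of A"
      hence "d \<noteq> []" using length_deck[OF d] assms by auto
      then obtain c a where c: "d = c @ [a]" by (metis rev_exhaust)
      have a: "a \<in> A" using set_deck[OF d] assms c by auto
      have "count (mset c) a = 1" using count_deck[OF d assms(1), of a] a c by simp
      hence "a \<in> set c" by (metis count_mset_0_iff zero_neq_one)
      then obtain ys zs where yz: "c = ys @ a # zs" by (meson split_list)
      have "ys @ zs \<in> decks_of (A - {a})"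
      proof -
        have "count (mset d) x = count (mset (ys @ zs)) x + (if x = a then 2 else 0)" for x
          by (simp add: c yz)
        hence "count (mset (ys @ zs)) x = (if x \<in> A - {a} then 2 else 0)" for x
          using count_deck[OF d assms(1), of x] a by (cases "x = a") auto
        thus ?thesis
          using assms(1) by (simp only: in_decks_of_iff finite_Diff) simp
      qed
      moreover have "length ys \<le> 2 * n"
        using len[OF a calculation] by simp
      moreover have "d = insert_pair_last a (length ys) (ys @ zs)"
        by (simp add: insert_pair_last_def c yz)
      ultimately show "d \<in> (\<lambda>(a, d, p). insert_pair_last a p d) ` ?S"
        using a by (intro image_eqI[of _ _ "(a, ys @ zs, length ys)"]) auto
    qed
  qed
  from sum.reindex_bij_betw[OF this, of f] show ?thesis
    using assms(1) by (simp add: sum.Sigma sum.cartesian_product case_prod_unfold)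
qed

text \<open>A deck may contain several adjacent pairs, so the bijection is onto decks with one of
  them marked; deleting the marked pair inverts the insertion.\<close>

lemma sum_decks_adjacent:
  fixes f :: "nat list \<Rightarrow> nat \<Rightarrow> real"
  assumes "finite A" "card A = Suc n"
  shows "(\<Sum>d\<in>decks_of A. \<Sum>p | p \<le> 2 * n \<and> d ! p = d ! Suc p. f d p) =
    (\<Sum>a\<in>A. \<Sum>d\<in>decks_of (A - {a}). \<Sum>p\<le>2 * n. f (insert_pair_adjacent a p d) p)"
proof -
  let ?S = "SIGMA a:A. decks_of (A - {a}) \<times> {..2 * n}"
  let ?T = "SIGMA d:decks_of A. {p. p \<le> 2 * n \<and> d ! p = d ! Suc p}"
  let ?g = "\<lambda>(a, d, p). (insert_pair_adjacent a p d, p)"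
  have len: "length d = 2 * n" "a \<notin> set d" if "a \<in> A" "d \<in> decks_of (A - {a})" for a d
    using length_deck[OF that(2)] set_deck[OF that(2)] assms that(1) by auto
  have "bij_betw ?g ?S ?T"
    unfolding bij_betw_def
  proof
    show "inj_on ?g ?S"
    proof (rule inj_onI, clarsimp)
      fix a d p b e
      assume *: "a \<in> A" "d \<in> decks_of (A - {a})" "b \<in> A" "e \<in> decks_of (A - {b})"
        "p \<le> 2 * n" "insert_pair_adjacent a p d = insert_pair_adjacent b p e"
      hence "length (take p d) = length (take p e)" using len[OF *(1,2)] len[OF *(3,4)] by simp
      hence "take p d = take p e \<and> a = b \<and> drop p d = drop p e"
        using *(6) by (simp add: insert_pair_adjacent_def)
      thus "a = b \<and> d = e" by (metis append_take_drop_id)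
    qed
    show "?g ` ?S = ?T"
    proof (intro equalityI subsetI)
      fix x assume "x \<in> ?g ` ?S"
      then obtain a d p where *: "x = (insert_pair_adjacent a p d, p)" "a \<in> A" "d \<in> decks_of (A - {a})" "p \<le> 2 * n"
        by auto
      thus "x \<in> ?T" using insert_pair_adjacent_deck[OF assms(1) *(2,3)] len[OF *(2,3)]
        by (auto simp: insert_pair_adjacent_def nth_append)
    next
      fix x assume "x \<in> ?T"
      then obtain d p where x: "x = (d, p)" and d: "d \<in> decks_of A" and p: "p \<le> 2 * n" "d ! p = d ! Suc p"
        by auto
      define a where "a = d ! p"
      have l: "length d = 2 * Suc n" using length_deck[OF d] assms by simp
      hence eq: "d = take p d @ a # a # drop (Suc (Suc p)) d"
        using p by (simp add: a_def Cons_nth_drop_Suc)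
           (metis Cons_nth_drop_Suc Suc_lessD a_def append_take_drop_id le_imp_less_Suc less_Suc_eq mult_Suc_right)
      have a: "a \<in> A" using set_deck[OF d] assms p l by (auto simp: a_def)
      let ?e = "take p d @ drop (Suc (Suc p)) d"
      have "count (mset d) x = count (mset ?e) x + (if x = a then 2 else 0)" for x
        by (subst eq) simp
      hence "count (mset ?e) x = (if x \<in> A - {a} then 2 else 0)" for x
        using count_deck[OF d assms(1), of x] a by (cases "x = a") auto
      hence "?e \<in> decks_of (A - {a})"
        using assms(1) by (simp only: in_decks_of_iff finite_Diff) simp
      moreover have "x = ?g (a, ?e, p)"
        using eq l p by (simp add: insert_pair_adjacent_def x)
      ultimately show "x \<in> ?g ` ?S" using a p by blast
    qed
  qed
  from sum.reindex_bij_betw[OF this, of "\<lambda>(d, p). f d p"] show ?thesis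
    using assms(1) by (simp add: sum.Sigma sum.cartesian_product case_prod_unfold)
qed

section \<open>Mean number of windows in a random deck\<close>

lemma windows_cong: "(\<And>i. i < M \<Longrightarrow> N i = N' i) \<Longrightarrow> windows N M j = windows N' M j"
  by (auto simp: windows_def window_def intro!: sum.cong)

lemma windows_Suc_False: "\<not> N M \<Longrightarrow> windows N (Suc M) (Suc j) = windows N M (Suc j)"
  by (cases "j \<le> M") (auto simp: windows_Suc window_Suc windows_eq_0)

text \<open>The number \<open>a\<close> is new, so old cards keep their status. The range of
  \<open>i\<close> stops just before the mate at the end.\<close>

lemma first_occ_insert_pair_last:
  assumes "a \<notin> set d" "p \<le> length d" "i \<le> length d"
  shows "first_occ (insert_pair_last a p d) i = insert_at p (first_occ d) i"
proof -
  consider "i < p" | "i = p" | "p < i"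
    by linarith
  thus ?thesis
  proof cases
    case 3
    then obtain k where k: "i = Suc k" "p \<le> k" by (cases i) auto
    have "set (take i (insert_pair_last a p d)) = insert a (set (take k d))"
    proof -
      have "take k d = take p d @ take (k - p) (drop p d)"
        using k take_add[of p "k - p" d] by simp
      thus ?thesis using k assms by (simp add: insert_pair_last_def Suc_diff_le)
    qed
    moreover have "insert_pair_last a p d ! i = d ! k" "d ! k \<noteq> a"
      using k assms by (auto simp: insert_pair_last_def nth_append Suc_diff_le)
    ultimately show ?thesis using k by (simp add: first_occ_def insert_at_def)
  qed (use assms in \<open>auto simp: first_occ_def insert_at_def insert_pair_last_def nth_append min_absorb1 dest: in_set_takeD\<close>)
qed

lemma not_first_occ_insert_pair_last:
  assumes "p \<le> length d"
  shows "\<not> first_occ (insert_pair_last a p d) (Suc (length d))"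
  using assms by (simp add: first_occ_def insert_pair_last_def nth_append Suc_diff_le)

lemma sum_windows_insert_pair_last:
  assumes "a \<notin> set d"
  shows "(\<Sum>p\<le>length d. windows (first_occ (insert_pair_last a p d)) (Suc (Suc (length d))) (Suc j)) =
    (real (length d) + 1 - real j) * windows (first_occ d) (length d) (Suc j)
      + (real j + 1) * windows (first_occ d) (length d) j"
proof -
  have "windows (first_occ (insert_pair_last a p d)) (Suc (Suc (length d))) (Suc j)
      = windows (insert_at p (first_occ d)) (Suc (length d)) (Suc j)" if "p \<le> length d" for p
  proof -
    have "windows (first_occ (insert_pair_last a p d)) (Suc (Suc (length d))) (Suc j)
        = windows (first_occ (insert_pair_last a p d)) (Suc (length d)) (Suc j)"
      by (rule windows_Suc_False) (rule not_first_occ_insert_pair_last[OF that])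
    also have "\<dots> = windows (insert_at p (first_occ d)) (Suc (length d)) (Suc j)"
      by (rule windows_cong) (use that assms in \<open>simp add: first_occ_insert_pair_last\<close>)
    finally show ?thesis .
  qed
  thus ?thesis using sum_windows_insert[where M = "length d" and N = "first_occ d" and j = j] by simp
qed

text \<open>Kept as a sum over \<open>a\<close>, so that averaging needs no formula for the number
  of decks.\<close>

lemma card_decks_of:
  assumes "finite A" "card A = Suc n"
  shows "real (card (decks_of A)) = (\<Sum>a\<in>A. real (card (decks_of (A - {a}))) * (2 * real n + 1))"
  using sum_decks_last[OF assms, of "\<lambda>_. 1"] by (simp add: add_ac)

lemma sum_windows_decks:
  assumes "finite A" "card A = n"
  shows "(\<Sum>d\<in>decks_of A. windows (first_occ d) (2 * n) j) = real (card (decks_of A)) * mean_windows n j"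
  using assms
proof (induction n arbitrary: A j)
  case 0
  thus ?case by (simp add: decks_of_empty windows_def window_def)
next
  case (Suc n)
  show ?case
  proof (cases j)
    case 0
    thus ?thesis by (simp add: windows_0 del: mult_Suc_right)
  next
    case (Suc k)
    have "(\<Sum>d\<in>decks_of A. windows (first_occ d) (2 * Suc n) j)
        = (\<Sum>a\<in>A. \<Sum>d\<in>decks_of (A - {a}). \<Sum>p\<le>2 * n.
             windows (first_occ (insert_pair_last a p d)) (2 * Suc n) j)"
      by (rule sum_decks_last[OF Suc.prems])
    also have "\<dots> = (\<Sum>a\<in>A. \<Sum>d\<in>decks_of (A - {a}).
        (2 * real n + 1 - real k) * windows (first_occ d) (2 * n) (Suc k)
        + (real k + 1) * windows (first_occ d) (2 * n) k)"
    proof (intro sum.cong refl)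
      fix a d assume *: "a \<in> A" "d \<in> decks_of (A - {a})"
      have "length d = 2 * n" "a \<notin> set d"
        using length_deck[OF *(2)] set_deck[OF *(2)] Suc.prems *(1) by auto
      thus "(\<Sum>p\<le>2 * n. windows (first_occ (insert_pair_last a p d)) (2 * Suc n) j)
          = (2 * real n + 1 - real k) * windows (first_occ d) (2 * n) (Suc k)
            + (real k + 1) * windows (first_occ d) (2 * n) k"
        using sum_windows_insert_pair_last[of a d k] Suc by simp
    qed
    also have "\<dots> = (\<Sum>a\<in>A. real (card (decks_of (A - {a}))) *
         ((2 * real n + 1 - real k) * mean_windows n (Suc k) + (real k + 1) * mean_windows n k))"
    proof (intro sum.cong refl)
      fix a assume "a \<in> A"
      hence A: "finite (A - {a})" "card (A - {a}) = n" using Suc.prems by auto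
      show "(\<Sum>d\<in>decks_of (A - {a}).
          (2 * real n + 1 - real k) * windows (first_occ d) (2 * n) (Suc k)
          + (real k + 1) * windows (first_occ d) (2 * n) k)
        = real (card (decks_of (A - {a}))) *
         ((2 * real n + 1 - real k) * mean_windows n (Suc k) + (real k + 1) * mean_windows n k)"
        unfolding sum.distrib sum_distrib_left[symmetric] Suc.IH[OF A] by (simp add: algebra_simps)
    qed
    also have "\<dots> = real (card (decks_of A)) * mean_windows (Suc n) j"
      unfolding card_decks_of[OF Suc.prems] Suc mean_windows_Suc_Suc[symmetric]
        sum_distrib_right by (simp only: mult.assoc)
    finally show ?thesis .
  qed
qed

section \<open>Means of the two kinds of phase starts\<close>

definition first_starts :: "nat list \<Rightarrow> real" where
  "first_starts d = (\<Sum>p<length d. of_bool (phase_start (first_occ d) p \<and> first_occ d p))"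

lemma sum_first_starts:
  assumes "finite A" "card A = n"
  shows "(\<Sum>d\<in>decks_of A. first_starts d) = real (card (decks_of A)) * mean_first_starts n"
proof -
  have "(\<Sum>d\<in>decks_of A. first_starts d)
      = (\<Sum>d\<in>decks_of A. \<Sum>j<2 * n. (- 1) ^ j * windows (first_occ d) (2 * n) (Suc j))"
    using assms by (intro sum.cong refl) (simp add: first_starts_def length_deck count_first_starts)
  also have "\<dots> = (\<Sum>j<2 * n. (- 1) ^ j * (real (card (decks_of A)) * mean_windows n (Suc j)))"
    by (subst sum.swap) (simp add: sum_windows_decks[OF assms] flip: sum_distrib_left)
  also have "\<dots> = (\<Sum>j<n. (- 1) ^ j * (real (card (decks_of A)) * mean_windows n (Suc j)))"
    by (rule sum.mono_neutral_right) (auto simp: mean_windows_eq_0)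
  finally show ?thesis by (simp add: mean_first_starts_def sum_distrib_left mult_ac)
qed

text \<open>The positions that are not phase starts are exactly the successors of phase starts at
  first cards.\<close>

lemma sum_phase_starts:
  "(\<Sum>p\<le>M. of_bool (phase_start N p) :: real) = real M + 1 - (\<Sum>p<M. of_bool (phase_start N p \<and> N p))"
  by (induction M) auto

text \<open>Indexed by adjacent pairs to fit \<open>sum_decks_adjacent\<close>; the left card of
  such a pair is automatically a first card (\<open>lucky_starts_eq\<close>).\<close>

definition lucky_starts :: "nat list \<Rightarrow> real" where
  "lucky_starts d = (\<Sum>p | Suc p < length d \<and> d ! p = d ! Suc p. of_bool (phase_start (first_occ d) p))"

text \<open>Whether \<open>p\<close> is a phase start depends only on the cards before
  \<open>p\<close>, which an insertion at \<open>p\<close> leaves alone. So the insertions into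
  \<open>d\<close> that count are as many as the phase starts of \<open>d\<close> among its
  \<open>2n + 1\<close> places.\<close>

lemma sum_lucky_starts:
  assumes "finite A" "card A = Suc n"
  shows "(\<Sum>d\<in>decks_of A. lucky_starts d) = real (card (decks_of A)) * (1 - scaled_mean n)"
proof -
  have "(\<Sum>d\<in>decks_of A. lucky_starts d)
      = (\<Sum>d\<in>decks_of A. \<Sum>p | p \<le> 2 * n \<and> d ! p = d ! Suc p. of_bool (phase_start (first_occ d) p))"
    using assms by (intro sum.cong refl) (simp add: lucky_starts_def length_deck less_Suc_eq_le)
  also have "\<dots> = (\<Sum>a\<in>A. \<Sum>d\<in>decks_of (A - {a}). \<Sum>p\<le>2 * n.
      of_bool (phase_start (first_occ (insert_pair_adjacent a p d)) p))"
    by (rule sum_decks_adjacent[OF assms])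
  also have "\<dots> = (\<Sum>a\<in>A. \<Sum>d\<in>decks_of (A - {a}). 2 * real n + 1 - first_starts d)"
  proof (intro sum.cong refl)
    fix a d assume *: "a \<in> A" "d \<in> decks_of (A - {a})"
    have len: "length d = 2 * n"
      using length_deck[OF *(2)] assms *(1) by auto
    have "phase_start (first_occ (insert_pair_adjacent a p d)) p = phase_start (first_occ d) p"
      if "p \<le> 2 * n" for p
      using that len
      by (intro phase_start_cong) (auto simp: first_occ_def insert_pair_adjacent_def nth_append min_absorb1)
    hence "(\<Sum>p\<le>2 * n. of_bool (phase_start (first_occ (insert_pair_adjacent a p d)) p))
        = (\<Sum>p\<le>2 * n. of_bool (phase_start (first_occ d) p) :: real)"
      by (intro sum.cong refl) auto
    thus "(\<Sum>p\<le>2 * n. of_bool (phase_start (first_occ (insert_pair_adjacent a p d)) p))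
        = 2 * real n + 1 - first_starts d"
      by (simp add: sum_phase_starts first_starts_def len)
  qed
  also have "\<dots> = (\<Sum>a\<in>A. real (card (decks_of (A - {a}))) * (2 * real n + 1 - mean_first_starts n))"
    using assms by (intro sum.cong refl) (simp add: sum_subtractf sum_first_starts algebra_simps)
  also have "\<dots> = real (card (decks_of A)) * (1 - scaled_mean n)"
  proof -
    have "2 * real n + 1 - mean_first_starts n = (2 * real n + 1) * (1 - scaled_mean n)"
    proof -
      have "2 * real n + 1 \<noteq> 0" by linarith
      thus ?thesis by (simp add: scaled_mean_def field_simps)
    qed
    thus ?thesis unfolding card_decks_of[OF assms] sum_distrib_right by (simp add: mult.assoc)
  qed
  finally show ?thesis .
qed

subsection \<open>The course of the game\<close>

lemma pair_self: "i < length d \<Longrightarrow> i \<in> pair d i"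
  by (simp add: pair_def positions_def)

lemma pair_eq: "j \<in> pair d i \<Longrightarrow> pair d j = pair d i"
  by (auto simp: pair_def)

text \<open>The set of removed positions at a phase start \<open>p\<close>, when exactly the
  positions below \<open>p\<close> are known and no known pair is in play.\<close>

definition completed :: "nat list \<Rightarrow> nat \<Rightarrow> nat set" where
  "completed d p = {i. i < p \<and> pair d i \<subseteq> {..<p}}"

lemma leftmost_unknown_lessThan: "p < length d \<Longrightarrow> leftmost_unknown d {..<p} = p"
  unfolding leftmost_unknown_def positions_def by (rule Min_eqI) auto

text \<open>The initial state is arbitrary, so that lengths can be accumulated backwards from the
  end of the game.\<close>

definition hits :: "nat list \<Rightarrow> nat set \<times> nat set \<Rightarrow> nat \<Rightarrow> bool" where
  "hits d s m \<longleftrightarrow> snd ((move d ^^ m) s) = positions d \<and> (\<forall>k<m. snd ((move d ^^ k) s) \<noteq> positions d)"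

lemma hits_Suc: "snd s \<noteq> positions d \<Longrightarrow> hits d (move d s) m \<Longrightarrow> hits d s (Suc m)"
  unfolding hits_def
  by (auto simp: funpow_Suc_right less_Suc_eq_0_disj simp del: funpow.simps(2))

lemma hits_imp_Least: "hits d s m \<Longrightarrow> (LEAST m. snd ((move d ^^ m) s) = positions d) = m"
  unfolding hits_def by (rule Least_equality) (auto simp: not_less[symmetric])

section \<open>Single moves and the length of a game\<close>

locale paired_deck =
  fixes d :: "nat list"
  assumes card_pair: "i < length d \<Longrightarrow> card (pair d i) = 2"
begin

lemma pair_not_first_occ:
  assumes "p < length d" "\<not> first_occ d p"
  shows "pair d p \<subseteq> {..<Suc p}"
proof -
  obtain i where i: "i < p" "d ! i = d ! p"
    using assms by (auto simp: first_occ_def in_set_conv_nth)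
  have "{i, p} = pair d p"
    using i assms card_pair[OF assms(1)]
    by (intro card_subset_eq) (auto simp: pair_def positions_def)
  moreover have "{i, p} \<subseteq> {..<Suc p}" using i by auto
  ultimately show ?thesis by simp
qed

lemma pair_first_occ:
  assumes "p < length d" "first_occ d p"
  shows "\<not> pair d p \<subseteq> {..<Suc p}"
proof
  assume "pair d p \<subseteq> {..<Suc p}"
  moreover have "\<not> j < p" if "j \<in> pair d p" for j
    using that assms(2) by (auto simp: first_occ_def in_set_conv_nth pair_def positions_def)
  ultimately have "pair d p \<subseteq> {p}"
    by force
  from card_mono[OF _ this] show False using card_pair[OF assms(1)] by simp
qed

lemma Suc_less_length_first_occ:
  assumes "p < length d" "first_occ d p"
  shows "Suc p < length d"
  using pair_first_occ[OF assms] by (auto simp: pair_def positions_def not_less)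

text \<open>A pair that becomes complete at this point must contain \<open>p\<close>.\<close>

lemma completed_Suc:
  assumes "p < length d"
  shows "completed d (Suc p) = completed d p \<union> (if first_occ d p then {} else pair d p)"
proof -
  have *: "pair d i \<subseteq> {..<p} \<or> pair d i = pair d p" if "pair d i \<subseteq> {..<Suc p}" for i
    using that pair_eq[of p d i] by (auto simp: less_Suc_eq)
  have "i < length d" if "i < p" for i using that assms by simp
  hence self: "i \<in> pair d i" if "i \<le> p" for i
    using that assms pair_self[of i d] by auto
  show ?thesis
  proof (cases "first_occ d p")
    case True
    thus ?thesis using pair_first_occ[OF assms True] * self
      by (auto simp: completed_def less_Suc_eq_le)
  next
    case False
    note sub = pair_not_first_occ[OF assms False]
    have "i \<in> completed d (Suc p)" if "i \<in> pair d p" for i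
      using sub that pair_eq[OF that] by (auto simp: completed_def)
    moreover have "i \<in> pair d p \<or> i \<in> completed d p" if "i \<in> completed d (Suc p)" for i
      using that *[of i] self[of i] by (auto simp: completed_def)
    moreover have "completed d p \<subseteq> completed d (Suc p)"
      by (force simp: completed_def)
    ultimately show ?thesis using False by auto
  qed
qed

lemma completed_neq_positions: "p < length d \<Longrightarrow> completed d p \<noteq> positions d"
  by (auto simp: completed_def positions_def)

lemma completed_length: "completed d (length d) = positions d"
  by (auto simp: completed_def positions_def pair_def)

lemma move_not_first_occ:
  assumes "p < length d" "\<not> first_occ d p"
  shows "move d ({..<p}, completed d p) = ({..<Suc p}, completed d (Suc p))"
proof -
  have "\<not> (\<exists>i\<in>{..<p} - completed d p. pair d i \<subseteq> {..<p})"
    by (auto simp: completed_def)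
  moreover have "insert p {..<p} = {..<Suc p}" by auto
  ultimately show ?thesis
    using assms pair_not_first_occ[OF assms]
    by (simp add: move_def leftmost_unknown_lessThan completed_Suc Let_def)
qed

lemma move_first_occ:
  assumes "p < length d" "first_occ d p"
  shows "move d ({..<p}, completed d p) =
    ({..<Suc (Suc p)}, if d ! Suc p = d ! p then completed d p \<union> pair d p else completed d p)"
proof -
  have "\<not> (\<exists>i\<in>{..<p} - completed d p. pair d i \<subseteq> {..<p})"
    by (auto simp: completed_def)
  moreover have "insert p {..<p} = {..<Suc p}" "insert (Suc p) {..<Suc p} = {..<Suc (Suc p)}" by auto
  ultimately show ?thesis
    using assms pair_first_occ[OF assms] Suc_less_length_first_occ[OF assms]
    by (simp add: move_def leftmost_unknown_lessThan Let_def)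
qed

text \<open>Describes the move after a failure whose second card has a known mate. The pair of
  \<open>Suc p\<close> is then the only known one in play, so \<open>Min\<close> must name one of
  its two positions.\<close>

lemma move_known_pair:
  assumes "Suc p < length d" "first_occ d p" "\<not> first_occ d (Suc p)"
  shows "move d ({..<Suc (Suc p)}, completed d p) = ({..<Suc (Suc p)}, completed d (Suc (Suc p)))"
proof -
  let ?K = "{..<Suc (Suc p)}"
  let ?S = "{i \<in> ?K - completed d p. pair d i \<subseteq> ?K}"
  have eq: "completed d (Suc (Suc p)) = completed d p \<union> pair d (Suc p)"
    using assms by (simp add: completed_Suc)
  have "?S \<subseteq> pair d (Suc p)"
    using eq by (auto simp: completed_def)
  moreover have "Suc p \<in> ?S"
    using pair_not_first_occ[OF assms(1,3)] by (auto simp: completed_def)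
  ultimately have "Min ?S \<in> pair d (Suc p)" "\<exists>i\<in>?K - completed d p. pair d i \<subseteq> ?K"
    using Min_in[of ?S] by (auto simp del: Min_in)
  thus ?thesis using pair_eq[of "Min ?S"] eq by (simp add: move_def)
qed

text \<open>
  The moves are charged to positions: a removal to the second card of its pair, an unsuccessful
  move to the first card it flips.
\<close>

definition step_cost :: "nat \<Rightarrow> nat" where
  "step_cost p = of_bool (\<not> first_occ d p) +
     of_bool (phase_start (first_occ d) p \<and> first_occ d p \<and> d ! Suc p \<noteq> d ! p)"

text \<open>Strong induction on the number of unknown cards: play passes from \<open>p\<close> to
  the next phase start, \<open>p + 1\<close> or \<open>p + 2\<close>, in as many moves as are
  charged to the positions passed.\<close>

lemma hits_from_phase_start:
  assumes "phase_start (first_occ d) p" "p \<le> length d"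
  shows "hits d ({..<p}, completed d p) (\<Sum>q=p..<length d. step_cost q)"
  using assms
proof (induction "length d - p" arbitrary: p rule: less_induct)
  case less
  let ?c = "\<lambda>p. \<Sum>q=p..<length d. step_cost q"
  show ?case
  proof (cases "p = length d")
    case True
    thus ?thesis by (simp add: hits_def completed_length)
  next
    case False
    hence p: "p < length d" using less.prems by simp
    have c: "?c p = step_cost p + ?c (Suc p)"
      using p by (simp add: sum.atLeast_Suc_lessThan)
    have not_done: "completed d p \<noteq> positions d" by (rule completed_neq_positions[OF p])
    show ?thesis
    proof (cases "first_occ d p")
      case False
      hence cost: "step_cost p = 1" by (simp add: step_cost_def)
      have "hits d ({..<Suc p}, completed d (Suc p)) (?c (Suc p))"
        using p False by (intro less.hyps) auto
      thus ?thesis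
        using hits_Suc[of "({..<p}, completed d p)" d "?c (Suc p)"] not_done False
        by (simp add: c cost move_not_first_occ[OF p])
    next
      case True
      have p2: "Suc p < length d" by (rule Suc_less_length_first_occ[OF p True])
      have start: "\<not> phase_start (first_occ d) (Suc p)" "phase_start (first_occ d) (Suc (Suc p))"
        using less.prems True by auto
      have c2: "?c p = step_cost p + step_cost (Suc p) + ?c (Suc (Suc p))"
        using p2 c by (simp add: sum.atLeast_Suc_lessThan)
      have IH: "hits d ({..<Suc (Suc p)}, completed d (Suc (Suc p))) (?c (Suc (Suc p)))"
        using p2 start by (intro less.hyps) auto
      note move1 = move_first_occ[OF p True]
      show ?thesis
      proof (cases "d ! Suc p = d ! p")
        case lucky: True
        have nf: "\<not> first_occ d (Suc p)"
          using lucky p by (simp add: first_occ_def take_Suc_conv_app_nth)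
        \<comment> \<open>One move, a removal, charged to the second card of the pair.\<close>
        have cost: "step_cost p = 0" "step_cost (Suc p) = 1"
          using True nf lucky by (simp_all add: step_cost_def)
        have "pair d (Suc p) = pair d p" using lucky by (simp add: pair_def)
        hence "move d ({..<p}, completed d p) = ({..<Suc (Suc p)}, completed d (Suc (Suc p)))"
          using move1 lucky nf True p p2 by (simp add: completed_Suc)
        thus ?thesis
          using hits_Suc[of "({..<p}, completed d p)" d] IH not_done
          by (simp add: c2 cost)
      next
        case unlucky: False
        show ?thesis
        proof (cases "first_occ d (Suc p)")
          case nf: True
          \<comment> \<open>One failed move that completes no pair.\<close>
          have cost: "step_cost p = 1" "step_cost (Suc p) = 0"
            using True nf unlucky less.prems by (simp_all add: step_cost_def)
          have "move d ({..<p}, completed d p) = ({..<Suc (Suc p)}, completed d (Suc (Suc p)))"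
            using move1 unlucky True nf p p2 by (simp add: completed_Suc)
          thus ?thesis
            using hits_Suc[of "({..<p}, completed d p)" d] IH not_done
            by (simp add: c2 cost)
        next
          case nf: False
          \<comment> \<open>Two moves: a failure that reveals the mate of an earlier card, then the
            removal of that pair.\<close>
          have cost: "step_cost p = 1" "step_cost (Suc p) = 1"
            using True nf unlucky less.prems by (simp_all add: step_cost_def)
          have "hits d ({..<Suc (Suc p)}, completed d p) (Suc (?c (Suc (Suc p))))"
            using hits_Suc[of "({..<Suc (Suc p)}, completed d p)" d] IH not_done
              move_known_pair[OF p2 True nf] by simp
          thus ?thesis
            using hits_Suc[of "({..<p}, completed d p)" d] move1 not_done unlucky
            by (simp add: c2 cost)
        qed
      qed
    qed
  qed
qed

lemma game_length_eq_step_cost: "game_length d = (\<Sum>q<length d. step_cost q)"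
proof -
  have "hits d ({}, {}) (\<Sum>q<length d. step_cost q)"
    using hits_from_phase_start[of 0] by (simp add: completed_def lessThan_atLeast0)
  thus ?thesis unfolding game_length_def by (rule hits_imp_Least)
qed

text \<open>In an adjacent pair the left card comes first; conversely a first card is never the last
  of the deck, so \<open>d ! Suc p\<close> stays in range.\<close>

lemma lucky_starts_eq:
  "lucky_starts d = (\<Sum>p<length d. of_bool (phase_start (first_occ d) p \<and> first_occ d p \<and> d ! Suc p = d ! p))"
proof -
  have "first_occ d p" if "Suc p < length d" "d ! p = d ! Suc p" for p
  proof (rule ccontr)
    assume "\<not> first_occ d p"
    hence "pair d p \<subseteq> {..<Suc p}" using that by (intro pair_not_first_occ) auto
    moreover have "Suc p \<in> pair d p" using that by (simp add: pair_def positions_def)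
    ultimately show False by auto
  qed
  hence "{p. Suc p < length d \<and> d ! p = d ! Suc p} \<inter> {p. phase_start (first_occ d) p}
      = {..<length d} \<inter> {p. phase_start (first_occ d) p \<and> first_occ d p \<and> d ! Suc p = d ! p}"
    using Suc_less_length_first_occ by auto
  moreover have "finite {p. Suc p < length d \<and> d ! p = d ! Suc p}"
    by (rule finite_subset[of _ "{..<length d}"]) auto
  ultimately show ?thesis by (simp add: lucky_starts_def flip: of_nat_sum)
qed

end

section \<open>Expected length and its asymptotics\<close>

lemma sum_first_occ: "(\<Sum>p<length d. of_bool (first_occ d p)) = card (set d)"
proof (induction d rule: rev_induct)
  case (snoc x d)
  have "(\<Sum>p<length d. of_bool (first_occ (d @ [x]) p)) = (\<Sum>p<length d. of_bool (first_occ d p) :: nat)"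
    by (intro sum.cong refl) (simp add: first_occ_def nth_append)
  thus ?case using snoc by (simp add: first_occ_def card_insert_if)
qed simp

lemma paired_deck:
  assumes "d \<in> decks_of A" "finite A"
  shows "paired_deck d"
proof
  fix i assume i: "i < length d"
  hence "d ! i \<in> A" using set_deck[OF assms] by auto
  hence "count (mset d) (d ! i) = 2" using count_deck[OF assms] by simp
  moreover have "pair d i = {j. j < length d \<and> d ! i = d ! j}"
    by (auto simp: pair_def positions_def)
  ultimately show "card (pair d i) = 2"
    by (simp add: count_mset count_list_eq_length_filter length_filter_conv_card)
qed

lemma game_length_deck:
  assumes "d \<in> decks_of A" "finite A"
  shows "real (game_length d) = real (card A) + first_starts d - lucky_starts d"
proof -
  interpret paired_deck d by (rule paired_deck[OF assms])
  have "(\<Sum>p<length d. of_bool (\<not> first_occ d p)) + (\<Sum>p<length d. of_bool (first_occ d p)) = (\<Sum>p<length d. 1::nat)"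
    unfolding sum.distrib[symmetric] by (intro sum.cong refl) simp
  hence 1: "(\<Sum>p<length d. of_bool (\<not> first_occ d p)) = card A"
    unfolding sum_first_occ set_deck[OF assms] using length_deck[OF assms(1)] by simp
  have 2: "(\<Sum>p<length d. of_bool (phase_start (first_occ d) p \<and> first_occ d p \<and> d ! Suc p \<noteq> d ! p))
      = first_starts d - lucky_starts d"
    unfolding first_starts_def lucky_starts_eq sum_subtractf[symmetric]
    by (intro sum.cong refl) auto
  have "real (game_length d) = real (\<Sum>p<length d. of_bool (\<not> first_occ d p)) +
     (\<Sum>p<length d. of_bool (phase_start (first_occ d) p \<and> first_occ d p \<and> d ! Suc p \<noteq> d ! p))"
    unfolding game_length_eq_step_cost step_cost_def by (simp add: sum.distrib)
  thus ?thesis unfolding 1 2 by simp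
qed

lemma expected_length_Suc:
  "expected_length (Suc n) = real (Suc n) + mean_first_starts (Suc n) - 1 + scaled_mean n"
proof -
  let ?A = "{1..Suc n}"
  have decks: "decks (Suc n) = decks_of ?A" by (simp add: decks_def decks_of_def)
  have "(\<Sum>d\<in>decks_of ?A. real (game_length d))
      = (\<Sum>d\<in>decks_of ?A. real (Suc n) + first_starts d - lucky_starts d)"
    by (intro sum.cong refl) (simp add: game_length_deck)
  also have "\<dots> = real (card (decks_of ?A)) * (real (Suc n) + mean_first_starts (Suc n) - (1 - scaled_mean n))"
    using sum_first_starts[of ?A "Suc n"] sum_lucky_starts[of ?A n]
    by (simp add: sum.distrib sum_subtractf algebra_simps)
  finally show ?thesis
    unfolding expected_length_def decks by (simp add: integral_pmf_of_set)
qed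

theorem theorem7:
  shows "\<exists>\<epsilon> :: nat \<Rightarrow> real.
    (\<forall>n \<ge> 1. expected_length n = (3 - 2 * ln 2) * real n + 7 / 8 - 2 * ln 2 + \<epsilon> n) \<and>
    \<epsilon> \<longlonglongrightarrow> 0"
proof (intro exI conjI allI impI)
  define \<epsilon> where "\<epsilon> n = expected_length n - ((3 - 2 * ln 2) * real n + 7 / 8 - 2 * ln 2)" for n
  show "expected_length n = (3 - 2 * ln 2) * real n + 7 / 8 - 2 * ln 2 + \<epsilon> n" for n
    by (simp add: \<epsilon>_def)
  \<comment> \<open>With \<open>N = Suc n\<close>, the limits contribute
    \<open>N + (2 * N + 1) * (1 - ln 2) - 1 / 8 - 1 + (1 - ln 2)\<close>, which is the claimed main
    term; two null sequences remain.\<close>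
  have "\<epsilon> (Suc n) = ((2 * real (Suc n) + 1) * (scaled_mean (Suc n) - (1 - ln 2)) + 1 / 8)
      + (scaled_mean n - (1 - ln 2))" for n
  proof -
    have "2 * real (Suc n) + 1 \<noteq> 0" by linarith
    hence "mean_first_starts (Suc n) = (2 * real (Suc n) + 1) * scaled_mean (Suc n)"
      by (simp add: scaled_mean_def)
    thus ?thesis by (simp add: \<epsilon>_def expected_length_Suc algebra_simps)
  qed
  moreover have "(\<lambda>n. ((2 * real (Suc n) + 1) * (scaled_mean (Suc n) - (1 - ln 2)) + 1 / 8)
      + (scaled_mean n - (1 - ln 2))) \<longlonglongrightarrow> 0"
    using tendsto_add[OF LIMSEQ_Suc[OF scaled_mean_second_order] LIM_zero[OF scaled_mean_limit]] by simp
  ultimately have "(\<lambda>n. \<epsilon> (Suc n)) \<longlonglongrightarrow> 0" by simp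
  thus "\<epsilon> \<longlonglongrightarrow> 0" by (rule LIMSEQ_imp_Suc)
qed

end
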